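(* Let $a\in U(A)$ and let $\mathcal{C}=(g(X))_{n,\sigma}^a$ be a principal $\sigma$-constacyclic code of length $n$, where $g(X)\in A[X;\sigma]$ is monic of degree $n-k$, is a right divisor of $X^n-a$, and is also a left divisor of $X^n-a$ with $X^n-a=g(X)h(X)$ for some $h(X)=\sum_{i=0}^k h_iX^i\in A[X;\sigma]$. Let $a_0=-a$ be the constant coefficient of $X^n-a$. Then the entries of a control matrix $H=(H_{i,j})\in M_{n,n}(A)$ of $\mathcal{C}$ (with $1\le i,j\le n$) are as follows. (a) If $n-k=1$, then $H_{1,j}=h_{j-1}$ for $1\le j\le n$ and, for $2\le i\le n$, $$H_{i,j}=\begin{cases}-\sigma^{j-1}(a_0)\,\sigma^{i-1}(h_{n-i+j}) & \text{if } 1\le j\le i-1,\\ \sigma^{i-1}(h_{j-i}) & \text{if } i\le j\le n.\end{cases}$$ (b) If $n-k\ge2$, then (i) for $i=1$: $H_{1,j}=h_{j-1}$ if $1\le j\le k+1$, and $H_{1,j}=0$ if $k+2\le j\le n$; (ii) for $2\le i\le n-k$: $$H_{i,j}=\begin{cases}0 & \text{if } 1\le j\le i-1,\\ \sigma^{i-1}(h_{j-i}) & \text{if } i\le j\le i+k,\\ 0 & \text{if } i+k+1\le j\le n;\end{cases}$$ (iii) for $n-k+1\le i\le n$: $$H_{i,j}=\begin{cases}-\sigma^{j-1}(a_0)\,\sigma^{i-1}(h_{n-i+j}) & \text{if } 1\le j\le i-(n-k),\\ 0 & \text{if } i-(n-k)+1\le j\le i-1,\\ \sigma^{i-1}(h_{j-i})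 & \text{if } i\le j\le n.\end{cases}$$
   Context: $A$ is a ring with identity (not necessarily finite or commutative), $U(A)$ its group of units, and $\sigma:A\to A$ a ring endomorphism with $\sigma(1)=1$. $A[X;\sigma]$ is the skew-polynomial ring (with zero derivation) of elements $\sum a_iX^i$ with multiplication determined by $Xa=\sigma(a)X$; $(p)_l$ is the left ideal generated by $p$. For $a\in U(A)$ and $g$ a right divisor of $X^n-a$, the principal $\sigma$-constacyclic code $(g(X))_{n,\sigma}^a$ is the set of $(d_0,\dots,d_{n-1})\in A^n$ with $\sum_{i=0}^{n-1}d_iX^i+(X^n-a)_l\in(g)_l/(X^n-a)_l$. For $H\in M_{n,t}(A)$ with $t\le n$, $\mathrm{Ann}_l(H)=\{x\in A^n:xH=0\}$; $H$ is a control matrix of such a code $\mathcal{C}\subseteq A^n$ if $\mathcal{C}=\mathrm{Ann}_l(H)$.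
   Formalization: In (a) and (b)(iii) the wrapped-around entries are proved with the factors in the opposite order, as −σ^{i−1}(h_{n−i+j})σ^{j−1}(a_0); the printed order fails for some noncommutative A, and the two agree when the factors commute. *)

theory Defs
  imports
    "HOL-Computational_Algebra.Polynomial"
    "HOL-Library.Set_Algebras"
    "Jordan_Normal_Form.Matrix"
begin

definition ring_units :: "'a::monoid_mult set" where
  "ring_units = {a. \<exists>b. a * b = 1 \<and> b * a = 1}"

definition unital_ring_endo :: "('a::ring_1 \<Rightarrow> 'a) \<Rightarrow> bool" where
  "unital_ring_endo \<sigma> \<longleftrightarrow>
     (\<forall>x y. \<sigma> (x + y) = \<sigma> x + \<sigma> y) \<and> (\<forall>x y. \<sigma> (x * y) = \<sigma> x * \<sigma> y) \<and> \<sigma> 1 = 1"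

text \<open>
  The additive group of the skew-polynomial ring $A[X;\sigma]$ is that of the type
  of ordinary polynomials (coefficients written on the left of the powers of $X$); the product
  is the one forced by $X a = \sigma(a) X$, i.e. $(a X^i)(b X^j) = a \sigma^i(b) X^{i+j}$.
\<close>

definition skew_mult :: "('a::ring_1 \<Rightarrow> 'a) \<Rightarrow> 'a poly \<Rightarrow> 'a poly \<Rightarrow> 'a poly" where
  "skew_mult \<sigma> p q =
     (\<Sum>i\<le>degree p. \<Sum>j\<le>degree q. monom (coeff p i * (\<sigma> ^^ i) (coeff q j)) (i + j))"

definition skew_right_divisor :: "('a::ring_1 \<Rightarrow> 'a) \<Rightarrow> 'a poly \<Rightarrow> 'a poly \<Rightarrow> bool" where
  "skew_right_divisor \<sigma> g f \<longleftrightarrow> (\<exists>q. f = skew_mult \<sigma> q g)"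

definition skew_left_ideal :: "('a::ring_1 \<Rightarrow> 'a) \<Rightarrow> 'a poly \<Rightarrow> 'a poly set" where
  "skew_left_ideal \<sigma> p = {skew_mult \<sigma> q p | q. True}"

definition Xn_minus :: "nat \<Rightarrow> 'a::ring_1 \<Rightarrow> 'a poly" where
  "Xn_minus n a = monom 1 n - [:a:]"

definition poly_of_word :: "'a::ring_1 vec \<Rightarrow> 'a poly" where
  "poly_of_word d = (\<Sum>i<dim_vec d. monom (d $ i) i)"

text \<open>The set of cosets $p + I$ with $p \in J$, for left ideals $I \subseteq J$.\<close>

definition quotient_cosets :: "'a::ring_1 poly set \<Rightarrow> 'a poly set \<Rightarrow> 'a poly set set" where
  "quotient_cosets J I = (\<lambda>p. p +o I) ` J"

definition constacyclic_code :: "('a::ring_1 \<Rightarrow> 'a) \<Rightarrow> nat \<Rightarrow> 'a \<Rightarrow> 'a poly \<Rightarrow> 'a vec set" where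
  "constacyclic_code \<sigma> n a g =
     {d \<in> carrier_vec n.
        poly_of_word d +o skew_left_ideal \<sigma> (Xn_minus n a)
          \<in> quotient_cosets (skew_left_ideal \<sigma> g) (skew_left_ideal \<sigma> (Xn_minus n a))}"

text \<open>
  Here $x$ is a row vector, and $x H = 0$ is spelled out columnwise; the entries of $x$ stand to
  the left of those of $H$ in the scalar product.
\<close>

definition Ann_l :: "'a::ring_1 mat \<Rightarrow> 'a vec set" where
  "Ann_l H = {x \<in> carrier_vec (dim_row H). \<forall>j<dim_col H. x \<bullet> col H j = 0}"

definition control_matrix :: "nat \<Rightarrow> nat \<Rightarrow> 'a::ring_1 mat \<Rightarrow> 'a vec set \<Rightarrow> bool" where
  "control_matrix n t H C \<longleftrightarrow> t \<le> n \<and> H \<in> carrier_mat n t \<and> C = Ann_l H"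

text \<open>Matrix entries with row and column indices counted from 1.\<close>

definition entry1 :: "'a mat \<Rightarrow> nat \<Rightarrow> nat \<Rightarrow> 'a" where
  "entry1 H i j = H $$ (i - 1, j - 1)"

text \<open>
  The wrapped-around entries, i.e. the coefficients of $X^{j-1}$ in $X^{i-1} h$ that arise from
  $c X^{n+j-1} \equiv c \sigma^{j-1}(a) X^{j-1}$ modulo the left ideal of $X^n - a$, have
  $c = \sigma^{i-1}(h_{n-i+j})$ as the left factor. The source prints the two factors in the
  opposite order, which gives the same entry when they commute (in particular if $A$ is
  commutative), but in general not a control matrix. Counterexample for the printed order:
  $B$ the ring of 2 by 2 integer matrices, $A = B \times B$, $\sigma(u,v) = (v,u)$, $d$ a unit
  of $A$ with $(d \sigma(d))^2 \neq (\sigma(d) d)^2$ (say, $d$ consisting of the two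
  elementary matrices with an extra entry 1 above, resp. below the diagonal), and $n = 3$, $k = 2$,
  $g = X - d$, $h = X^2 + \sigma(d) X + \sigma(d) d$, $a = d \sigma(d) d$.
\<close>

end

theory Submission
  imports Defs
begin

text \<open>
  Write $f = X^n - a$ and let $A[X;\sigma] f$ be the left ideal it generates. Row $i$ of the matrix
  lists the coefficients of the remainder of $X^{i-1} h$ modulo $A[X;\sigma] f$, so $d H$ lists
  those of the remainder of $d(X) h$; hence $d H = 0$ means $d(X) h \in A[X;\sigma] f$. As
  $f$ is monic, this membership can be read off from coefficients when the product has degree
  less than $2n$ (\<open>in_left_ideal_Xn_minus_iff\<close>): $c X^{n+m}$ is replaced by
  $c \sigma^m(a) X^m$. The wrapped-around entries of $H$ come from this substitution.

  It remains to see that $d h \in A[X;\sigma] f$ exactly when $d \in A[X;\sigma] g$. If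
  $d = p g$, then $d h = p g h = p f$. Conversely, $d h = p f = p g h$ gives $d = p g$ once $h$
  can be cancelled on the right. Cancellation cannot rest on the leading coefficient of $h$:
  the equation $f = g h$ only says that $\sigma^{n-k}(h_k) = 1$, and $\sigma$ may fail to be
  injective. The constant coefficient works instead. From $f = q g = g h$ one gets
  $q_0 g_0 = -a = g_0 h_0$ with $a$ a unit, so $g_0$ and therefore $h_0$ are units, and so are all
  $\sigma^i(h_0)$; comparing lowest terms then yields $p h = 0 \Longrightarrow p = 0$.

  The entries describe these remainders when $k < n$, so that no coefficient of $X^{i-1} h$ and
  its wrapped-around image compete for one entry. For $k = n$ one has $g = 1$, the code is the
  whole of $A^n$, and the zero matrix is a control matrix.
\<close>

section \<open>Arithmetic of skew polynomials\<close>

locale skew_polynomials =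
  fixes \<sigma> :: "'a::ring_1 \<Rightarrow> 'a"
  assumes endo: "unital_ring_endo \<sigma>"
begin

lemma pow_add: "(\<sigma> ^^ i) (x + y) = (\<sigma> ^^ i) x + (\<sigma> ^^ i) y"
  using endo by (induction i) (auto simp: unital_ring_endo_def)

lemma pow_mult: "(\<sigma> ^^ i) (x * y) = (\<sigma> ^^ i) x * (\<sigma> ^^ i) y"
  using endo by (induction i) (auto simp: unital_ring_endo_def)

lemma pow_one [simp]: "(\<sigma> ^^ i) 1 = 1"
  using endo by (induction i) (auto simp: unital_ring_endo_def)

lemma pow_zero [simp]: "(\<sigma> ^^ i) 0 = 0"
  using pow_add[of i 0 0] by simp

lemma pow_uminus: "(\<sigma> ^^ i) (- x) = - (\<sigma> ^^ i) x"
  using pow_add[of i x "- x"] by (simp add: eq_neg_iff_add_eq_0 add.commute)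

lemma coeff_skew_mult:
  "coeff (skew_mult \<sigma> p q) m = (\<Sum>i\<le>m. coeff p i * (\<sigma> ^^ i) (coeff q (m - i)))"
proof -
  let ?t = "\<lambda>i. coeff p i * (\<sigma> ^^ i) (coeff q (m - i))"
  have inner: "(\<Sum>j\<le>degree q. if i + j = m then coeff p i * (\<sigma> ^^ i) (coeff q j) else 0)
      = (if i \<le> m then ?t i else 0)" for i
  proof -
    have "(\<Sum>j\<le>degree q. if i + j = m then coeff p i * (\<sigma> ^^ i) (coeff q j) else 0)
        = (\<Sum>j\<le>degree q. if j = m - i then (if i \<le> m then ?t i else 0) else 0)"
      by (intro sum.cong) auto
    also have "\<dots> = (if i \<le> m then ?t i else 0)"
      by (auto simp: coeff_eq_0)
    finally show ?thesis .
  qed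
  have "coeff (skew_mult \<sigma> p q) m = (\<Sum>i\<le>degree p. if i \<le> m then ?t i else 0)"
    by (simp add: skew_mult_def coeff_sum coeff_monom inner)
  also have "\<dots> = (\<Sum>i\<in>{..degree p} \<inter> {..m}. ?t i)"
    by (subst sum.inter_restrict) simp_all
  also have "\<dots> = (\<Sum>i\<le>m. ?t i)"
    by (intro sum.mono_neutral_left) (auto intro!: le_degree)
  finally show ?thesis .
qed

lemma skew_mult_add_left: "skew_mult \<sigma> (p + p') q = skew_mult \<sigma> p q + skew_mult \<sigma> p' q"
  by (rule poly_eqI) (simp add: coeff_skew_mult sum.distrib distrib_right)

lemma skew_mult_add_right: "skew_mult \<sigma> p (q + q') = skew_mult \<sigma> p q + skew_mult \<sigma> p q'"
  by (rule poly_eqI) (simp add: coeff_skew_mult sum.distrib distrib_left pow_add)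

lemma skew_mult_zero_left [simp]: "skew_mult \<sigma> 0 q = 0"
  by (rule poly_eqI) (simp add: coeff_skew_mult)

lemma skew_mult_zero_right [simp]: "skew_mult \<sigma> p 0 = 0"
  by (rule poly_eqI) (simp add: coeff_skew_mult)

lemma skew_mult_diff_left: "skew_mult \<sigma> (p - p') q = skew_mult \<sigma> p q - skew_mult \<sigma> p' q"
  by (metis add_diff_cancel diff_add_cancel skew_mult_add_left)

lemma skew_mult_sum_left: "skew_mult \<sigma> (sum F I) q = (\<Sum>i\<in>I. skew_mult \<sigma> (F i) q)"
  by (induction I rule: infinite_finite_induct) (auto simp: skew_mult_add_left)

lemma skew_mult_sum_right: "skew_mult \<sigma> p (sum F I) = (\<Sum>i\<in>I. skew_mult \<sigma> p (F i))"
  by (induction I rule: infinite_finite_induct) (auto simp: skew_mult_add_right)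

lemma skew_mult_one_right: "skew_mult \<sigma> p (monom 1 0) = p"
proof (rule poly_eqI)
  fix m
  have "coeff (skew_mult \<sigma> p (monom 1 0)) m = (\<Sum>i\<le>m. if i = m then coeff p i else 0)"
    unfolding coeff_skew_mult by (intro sum.cong) (auto simp: coeff_monom)
  then show "coeff (skew_mult \<sigma> p (monom 1 0)) m = coeff p m"
    by simp
qed

lemma skew_mult_monom: "skew_mult \<sigma> (monom x i) (monom y j) = monom (x * (\<sigma> ^^ i) y) (i + j)"
proof (rule poly_eqI)
  fix m
  have "coeff (skew_mult \<sigma> (monom x i) (monom y j)) m
      = (\<Sum>l\<le>m. if l = i then (if i + j = m then x * (\<sigma> ^^ i) y else 0) else 0)"
    unfolding coeff_skew_mult by (intro sum.cong) (auto simp: coeff_monom)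
  then show "coeff (skew_mult \<sigma> (monom x i) (monom y j)) m
      = coeff (monom (x * (\<sigma> ^^ i) y) (i + j)) m"
    by (auto simp: coeff_monom)
qed

text \<open>
  The product is biadditive and monomials span additively, so associativity only has to be
  checked on monomials, where it is multiplicativity of $\sigma^i$.
\<close>

lemma skew_mult_assoc:
  "skew_mult \<sigma> (skew_mult \<sigma> p q) r = skew_mult \<sigma> p (skew_mult \<sigma> q r)"
proof -
  have monoms: "skew_mult \<sigma> (skew_mult \<sigma> (monom x i) (monom y j)) (monom z l)
      = skew_mult \<sigma> (monom x i) (skew_mult \<sigma> (monom y j) (monom z l))" for x y z i j l
    by (simp add: skew_mult_monom pow_mult funpow_add mult.assoc add.assoc)
  have "skew_mult \<sigma> (skew_mult \<sigma> (\<Sum>i\<le>degree p. monom (coeff p i) i)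
          (\<Sum>i\<le>degree q. monom (coeff q i) i)) (\<Sum>i\<le>degree r. monom (coeff r i) i)
      = skew_mult \<sigma> (\<Sum>i\<le>degree p. monom (coeff p i) i)
          (skew_mult \<sigma> (\<Sum>i\<le>degree q. monom (coeff q i) i)
            (\<Sum>i\<le>degree r. monom (coeff r i) i))"
    by (simp only: skew_mult_sum_left skew_mult_sum_right monoms)
  then show ?thesis
    by (simp only: poly_as_sum_of_monoms)
qed

text \<open>
  If $p \neq 0$ has lowest term $p_l X^l$, the coefficient of $X^l$ in $p h$ is
  $p_l \sigma^l(h_0)$, and $\sigma^l(h_0)$ inherits the right inverse of $h_0$.
\<close>

lemma skew_mult_right_cancel_zero:
  assumes "coeff h 0 * w = 1" and "skew_mult \<sigma> p h = 0"
  shows "p = 0"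
proof (rule poly_eqI)
  fix m
  show "coeff p m = coeff 0 m"
  proof (induction m rule: less_induct)
    case (less m)
    have "0 = (\<Sum>i\<le>m. coeff p i * (\<sigma> ^^ i) (coeff h (m - i)))"
      using assms(2) by (simp flip: coeff_skew_mult)
    also have "\<dots> = coeff p m * (\<sigma> ^^ m) (coeff h 0)"
      using less.IH by (subst sum.remove[of _ m]) auto
    finally have "0 = coeff p m * (\<sigma> ^^ m) (coeff h 0) * (\<sigma> ^^ m) w"
      by simp
    also have "\<dots> = coeff p m"
      by (simp add: mult.assoc assms(1) flip: pow_mult)
    finally show ?case by simp
  qed
qed

section \<open>Left ideals and constacyclic codes\<close>

lemma coeff_skew_mult_Xn_minus:
  assumes "0 < n"
  shows "coeff (skew_mult \<sigma> s (Xn_minus n a)) l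
    = (if n \<le> l then coeff s (l - n) else 0) - coeff s l * (\<sigma> ^^ l) a"
proof -
  have "coeff (skew_mult \<sigma> s (Xn_minus n a)) l
      = (\<Sum>i\<le>l. (if i = l - n then (if n \<le> l then coeff s (l - n) else 0) else 0)
          - (if i = l then coeff s l * (\<sigma> ^^ l) a else 0))"
    unfolding coeff_skew_mult Xn_minus_def using assms
    by (intro sum.cong)
       (auto simp: coeff_monom coeff_pCons pow_uminus split: nat.split)
  then show ?thesis
    by (simp add: sum_subtractf)
qed

text \<open>
  A multiple $s (X^n - a)$ of degree less than $2n$ forces $s$ to have degree less than $n$:
  otherwise the leading coefficient of $s$ would survive as a coefficient of the product in
  degree at least $2n$. So $s$ must be the part of $p$ in degrees $n$ and higher, shifted down
  by $n$, and the low coefficients give the condition.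
\<close>

lemma in_left_ideal_Xn_minus_iff:
  assumes "0 < n" and high: "\<And>l. 2 * n \<le> l \<Longrightarrow> coeff p l = 0"
  shows "p \<in> skew_left_ideal \<sigma> (Xn_minus n a)
    \<longleftrightarrow> (\<forall>m<n. coeff p m + coeff p (n + m) * (\<sigma> ^^ m) a = 0)"
proof
  assume "p \<in> skew_left_ideal \<sigma> (Xn_minus n a)"
  then obtain s where p: "p = skew_mult \<sigma> s (Xn_minus n a)"
    by (auto simp: skew_left_ideal_def)
  have deg: "s = 0 \<or> degree s < n"
  proof (rule ccontr)
    assume *: "\<not> (s = 0 \<or> degree s < n)"
    have "coeff p (degree s + n) = coeff s (degree s)"
      using \<open>0 < n\<close> by (simp add: p coeff_skew_mult_Xn_minus coeff_eq_0)
    moreover have "coeff p (degree s + n) = 0"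
      using * by (intro high) simp
    ultimately show False
      using * by simp
  qed
  show "\<forall>m<n. coeff p m + coeff p (n + m) * (\<sigma> ^^ m) a = 0"
  proof (intro allI impI)
    fix m assume "m < n"
    have "coeff s (n + m) = 0"
      using deg by (auto simp: coeff_eq_0)
    then show "coeff p m + coeff p (n + m) * (\<sigma> ^^ m) a = 0"
      using \<open>0 < n\<close> \<open>m < n\<close> by (simp add: p coeff_skew_mult_Xn_minus)
  qed
next
  assume low: "\<forall>m<n. coeff p m + coeff p (n + m) * (\<sigma> ^^ m) a = 0"
  have "p = skew_mult \<sigma> (poly_shift n p) (Xn_minus n a)"
  proof (rule poly_eqI)
    fix l
    show "coeff p l = coeff (skew_mult \<sigma> (poly_shift n p) (Xn_minus n a)) l"
    proof (cases "n \<le> l")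
      case True
      then show ?thesis
        using \<open>0 < n\<close> high[of "n + l"]
        by (simp add: coeff_skew_mult_Xn_minus coeff_poly_shift add.commute)
    next
      case False
      then show ?thesis
        using \<open>0 < n\<close> low
        by (simp add: coeff_skew_mult_Xn_minus coeff_poly_shift eq_neg_iff_add_eq_0 add.commute)
    qed
  qed
  then show "p \<in> skew_left_ideal \<sigma> (Xn_minus n a)"
    by (auto simp: skew_left_ideal_def)
qed

lemma constacyclic_code_iff:
  assumes "skew_right_divisor \<sigma> g (Xn_minus n a)"
  shows "d \<in> constacyclic_code \<sigma> n a g
    \<longleftrightarrow> d \<in> carrier_vec n \<and> poly_of_word d \<in> skew_left_ideal \<sigma> g"
proof -
  let ?I = "skew_left_ideal \<sigma> (Xn_minus n a)" and ?J = "skew_left_ideal \<sigma> g"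
  obtain q where q: "Xn_minus n a = skew_mult \<sigma> q g"
    using assms by (auto simp: skew_right_divisor_def)
  have sub: "?I \<subseteq> ?J"
    by (auto simp: skew_left_ideal_def q simp flip: skew_mult_assoc)
  have zero: "0 \<in> ?I"
    by (auto simp: skew_left_ideal_def intro: exI[of _ 0])
  have add: "x + y \<in> ?J" if "x \<in> ?J" "y \<in> ?J" for x y
    using that by (auto simp: skew_left_ideal_def simp flip: skew_mult_add_left)
  have code: "p \<in> ?J" if p: "p +o ?I \<in> quotient_cosets ?J ?I" for p
  proof -
    obtain p' where p': "p' \<in> ?J" "p +o ?I = p' +o ?I"
      using p by (auto simp: quotient_cosets_def)
    have "p \<in> p +o ?I"
      using zero by (force simp: elt_set_plus_def)
    then obtain y where "y \<in> ?I" "p = p' + y"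
      unfolding p'(2) by (auto simp: elt_set_plus_def)
    then show ?thesis
      using p'(1) sub add by auto
  qed
  have "p +o ?I \<in> quotient_cosets ?J ?I \<longleftrightarrow> p \<in> ?J" for p
    using code unfolding quotient_cosets_def by blast
  then show ?thesis
    by (simp only: constacyclic_code_def mem_Collect_eq)
qed

lemma coeff_poly_of_word: "coeff (poly_of_word d) i = (if i < dim_vec d then d $ i else 0)"
  by (simp add: poly_of_word_def coeff_sum coeff_monom)

text \<open>
  The two factorisations of $X^n - a$ make $g_0$ invertible on both sides, and it is this
  two-sidedness that turns the factorisation $g_0 h_0 = -a$ into a right inverse of $h_0$.
\<close>

lemma constant_coeff_cofactor_right_invertible:
  assumes "a \<in> ring_units" and "0 < n"
    and "skew_right_divisor \<sigma> g (Xn_minus n a)" and "Xn_minus n a = skew_mult \<sigma> g h"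
  shows "\<exists>w. coeff h 0 * w = 1"
proof -
  obtain b where b: "a * b = 1" "b * a = 1"
    using assms(1) by (auto simp: ring_units_def)
  obtain q where q: "Xn_minus n a = skew_mult \<sigma> q g"
    using assms(3) by (auto simp: skew_right_divisor_def)
  have a0: "coeff (Xn_minus n a) 0 = - a"
    using \<open>0 < n\<close> by (simp add: Xn_minus_def coeff_monom)
  have gh: "coeff g 0 * coeff h 0 = - a"
    using a0 by (simp add: assms(4) coeff_skew_mult)
  have qg: "coeff q 0 * coeff g 0 = - a"
    using a0 by (simp add: q coeff_skew_mult)
  have left: "(- b * coeff q 0) * coeff g 0 = 1"
    using b by (simp add: mult.assoc qg)
  have right: "coeff g 0 * (coeff h 0 * (- b)) = 1"
    using b by (simp add: gh flip: mult.assoc)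
  have "- b * coeff q 0 = (- b * coeff q 0) * (coeff g 0 * (coeff h 0 * (- b)))"
    unfolding right by simp
  also have "\<dots> = ((- b * coeff q 0) * coeff g 0) * (coeff h 0 * (- b))"
    by (simp only: mult.assoc)
  also have "\<dots> = coeff h 0 * (- b)"
    unfolding left by simp
  finally have "coeff h 0 * (- b) * coeff g 0 = 1"
    using left by (simp only:)
  then have "coeff h 0 * (- b * coeff g 0) = 1"
    by (simp only: mult.assoc)
  then show ?thesis ..
qed

text \<open>
  So $h$ is a check polynomial for the code: right multiplication by $h$ carries the left ideal
  of $g$ into that of $g h = X^n - a$, and cancelling $h$ leads back.
\<close>

lemma constacyclic_code_iff_check_polynomial:
  assumes "a \<in> ring_units" and "0 < n"
    and "skew_right_divisor \<sigma> g (Xn_minus n a)" and f: "Xn_minus n a = skew_mult \<sigma> g h"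
  shows "d \<in> constacyclic_code \<sigma> n a g \<longleftrightarrow>
    d \<in> carrier_vec n \<and> skew_mult \<sigma> (poly_of_word d) h \<in> skew_left_ideal \<sigma> (Xn_minus n a)"
proof -
  obtain w where w: "coeff h 0 * w = 1"
    using constant_coeff_cofactor_right_invertible[OF assms] ..
  have "p \<in> skew_left_ideal \<sigma> g
      \<longleftrightarrow> skew_mult \<sigma> p h \<in> skew_left_ideal \<sigma> (Xn_minus n a)" for p
  proof
    assume "p \<in> skew_left_ideal \<sigma> g"
    then show "skew_mult \<sigma> p h \<in> skew_left_ideal \<sigma> (Xn_minus n a)"
      by (auto simp: skew_left_ideal_def f skew_mult_assoc)
  next
    assume "skew_mult \<sigma> p h \<in> skew_left_ideal \<sigma> (Xn_minus n a)"
    then obtain s where "skew_mult \<sigma> p h = skew_mult \<sigma> (skew_mult \<sigma> s g) h"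
      by (auto simp: skew_left_ideal_def f skew_mult_assoc)
    then have "skew_mult \<sigma> (p - skew_mult \<sigma> s g) h = 0"
      by (simp add: skew_mult_diff_left)
    then have "p = skew_mult \<sigma> s g"
      using skew_mult_right_cancel_zero[OF w] by fastforce
    then show "p \<in> skew_left_ideal \<sigma> g"
      by (auto simp: skew_left_ideal_def)
  qed
  then show ?thesis
    using constacyclic_code_iff[OF assms(3)] by simp
qed

section \<open>The control matrix\<close>

text \<open>
  Row $i$, counted from $0$, holds the coefficients of the remainder of $X^i h$ modulo the left
  ideal of $X^n - a$; the formula is this remainder only if $h$ has degree less than $n$, since
  otherwise a coefficient can receive both an unwrapped and a wrapped-around contribution.
\<close>

definition remainder_matrix :: "nat \<Rightarrow> 'a \<Rightarrow> 'a poly \<Rightarrow> 'a mat" where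
  "remainder_matrix n a h = mat n n (\<lambda>(i, m).
     if i \<le> m then (\<sigma> ^^ i) (coeff h (m - i))
     else (\<sigma> ^^ i) (coeff h (n + m - i)) * (\<sigma> ^^ m) a)"

text \<open>
  The rows $i \le m$ contribute the coefficient of $X^m$ in $d(X) h$, and the rows $i > m$ that of
  $X^{n+m}$, moved to degree $m$.
\<close>

lemma scalar_prod_col_remainder_matrix:
  assumes "d \<in> carrier_vec n" and "m < n" and "degree h < n"
  defines "c \<equiv> skew_mult \<sigma> (poly_of_word d) h"
  shows "d \<bullet> col (remainder_matrix n a h) m = coeff c m + coeff c (n + m) * (\<sigma> ^^ m) a"
proof -
  let ?t = "\<lambda>l i. d $ i * (\<sigma> ^^ i) (coeff h (l - i))"
  have low: "coeff c m = (\<Sum>i\<le>m. ?t m i)"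
    unfolding c_def coeff_skew_mult
    using assms(1,2) by (intro sum.cong) (auto simp: coeff_poly_of_word)
  \<comment> \<open>Rows $i \le m$ drop out here: they involve $h_{n+m-i}$ with index at least $n$.\<close>
  have "coeff c (n + m) = (\<Sum>i\<in>{m<..<n}. ?t (n + m) i)"
    unfolding c_def coeff_skew_mult
    using assms(1-3)
    by (intro sum.mono_neutral_cong_right) (auto simp: coeff_poly_of_word coeff_eq_0)
  then have high: "coeff c (n + m) * (\<sigma> ^^ m) a
      = (\<Sum>i\<in>{m<..<n}. ?t (n + m) i * (\<sigma> ^^ m) a)"
    by (simp add: sum_distrib_right)
  have split: "{0..<n} = {..m} \<union> {m<..<n}"
    using assms(2) by auto
  have "d \<bullet> col (remainder_matrix n a h) m
      = (\<Sum>i\<in>{0..<n}. if i \<le> m then ?t m i else ?t (n + m) i * (\<sigma> ^^ m) a)"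
    unfolding scalar_prod_def using assms(2)
    by (intro sum.cong) (auto simp: remainder_matrix_def mult.assoc)
  also have "\<dots> = (\<Sum>i\<le>m. ?t m i) + (\<Sum>i\<in>{m<..<n}. ?t (n + m) i * (\<sigma> ^^ m) a)"
    unfolding split by (subst sum.union_disjoint) (auto intro!: arg_cong2[of _ _ _ _ "(+)"] sum.cong)
  finally show ?thesis
    by (simp only: low high)
qed

lemma control_matrix_remainder_matrix:
  assumes "a \<in> ring_units" and "0 < n" and deg: "degree h < n"
    and "skew_right_divisor \<sigma> g (Xn_minus n a)" and "Xn_minus n a = skew_mult \<sigma> g h"
  shows "control_matrix n n (remainder_matrix n a h) (constacyclic_code \<sigma> n a g)"
proof -
  let ?H = "remainder_matrix n a h"
  have H: "?H \<in> carrier_mat n n"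
    by (simp add: remainder_matrix_def)
  have "d \<in> constacyclic_code \<sigma> n a g \<longleftrightarrow> d \<in> Ann_l ?H" for d
  proof (cases "d \<in> carrier_vec n")
    case True
    let ?c = "skew_mult \<sigma> (poly_of_word d) h"
    have "coeff ?c l = 0" if "2 * n \<le> l" for l
      unfolding coeff_skew_mult
    proof (intro sum.neutral ballI)
      fix i
      show "coeff (poly_of_word d) i * (\<sigma> ^^ i) (coeff h (l - i)) = 0"
        using that deg True
        by (cases "i < n") (auto simp: coeff_poly_of_word coeff_eq_0)
    qed
    then show ?thesis
      using True H deg
      by (simp add: constacyclic_code_iff_check_polynomial[OF assms(1,2,4,5)]
          in_left_ideal_Xn_minus_iff[OF \<open>0 < n\<close>] Ann_l_def scalar_prod_col_remainder_matrix)
  next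
    case False
    then show ?thesis
      using H by (auto simp: constacyclic_code_def Ann_l_def)
  qed
  then show ?thesis
    using H by (auto simp: control_matrix_def)
qed

lemma entry1_remainder_matrix:
  assumes "i \<in> {1..n}" and "j \<in> {1..n}"
  shows "entry1 (remainder_matrix n a h) i j =
    (if j \<le> i - 1 then - ((\<sigma> ^^ (i - 1)) (coeff h (n - i + j)) * (\<sigma> ^^ (j - 1)) (- a))
     else (\<sigma> ^^ (i - 1)) (coeff h (j - i)))"
proof -
  have "n + (j - 1) - (i - 1) = n - i + j" and "j - 1 - (i - 1) = j - i"
    using assms by auto
  then show ?thesis
    using assms by (auto simp: entry1_def remainder_matrix_def pow_uminus)
qed

text \<open>
  The case $g = 1$: every $p = p \cdot 1$ lies in the left ideal of $g$, so every word is a codeword.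
\<close>

lemma control_matrix_zero_matrix:
  assumes "skew_right_divisor \<sigma> (monom 1 0) (Xn_minus n a)"
  shows "control_matrix n n (0\<^sub>m n n) (constacyclic_code \<sigma> n a (monom 1 0))"
proof -
  have "p \<in> skew_left_ideal \<sigma> (monom 1 0)" for p
    using skew_mult_one_right[of p, symmetric] by (auto simp: skew_left_ideal_def)
  then show ?thesis
    by (auto simp: control_matrix_def Ann_l_def constacyclic_code_iff[OF assms])
qed

end

theorem corollary5p4:
  fixes \<sigma> :: "'a::ring_1 \<Rightarrow> 'a"
    and a a0 :: 'a
    and g h :: "'a poly"
    and n k :: nat
    and C :: "'a vec set"
  assumes "unital_ring_endo \<sigma>"
    and "a \<in> ring_units"
    and "0 < n" and "k \<le> n"
    and "degree g = n - k" and "coeff g (n - k) = 1"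
    and "skew_right_divisor \<sigma> g (Xn_minus n a)"
    and "Xn_minus n a = skew_mult \<sigma> g h"
    and "degree h \<le> k"
    and "C = constacyclic_code \<sigma> n a g"
    and "a0 = - a"
  shows "\<exists>H. control_matrix n n H C \<and>
    (n - k = 1 \<longrightarrow>
      (\<forall>j\<in>{1..n}. entry1 H 1 j = coeff h (j - 1)) \<and>
      (\<forall>i\<in>{2..n}. \<forall>j\<in>{1..n}. entry1 H i j =
        (if j \<le> i - 1 then - ((\<sigma> ^^ (i - 1)) (coeff h (n - i + j)) * (\<sigma> ^^ (j - 1)) a0)
         else (\<sigma> ^^ (i - 1)) (coeff h (j - i))))) \<and>
    (n - k \<ge> 2 \<longrightarrow>
      (\<forall>j\<in>{1..n}. entry1 H 1 j = (if j \<le> k + 1 then coeff h (j - 1) else 0)) \<and>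
      (\<forall>i\<in>{2..n - k}. \<forall>j\<in>{1..n}. entry1 H i j =
        (if j \<le> i - 1 then 0
         else if j \<le> i + k then (\<sigma> ^^ (i - 1)) (coeff h (j - i))
         else 0)) \<and>
      (\<forall>i\<in>{n - k + 1..n}. \<forall>j\<in>{1..n}. entry1 H i j =
        (if j \<le> i - (n - k) then - ((\<sigma> ^^ (i - 1)) (coeff h (n - i + j)) * (\<sigma> ^^ (j - 1)) a0)
         else if j \<le> i - 1 then 0
         else (\<sigma> ^^ (i - 1)) (coeff h (j - i)))))"
proof -
  interpret skew_polynomials \<sigma>
    by unfold_locales (fact assms(1))
  show ?thesis
  proof (cases "k = n")
    case True
    have "degree g = 0"
      using assms(5) True by simp
    then have "g = monom 1 0"
      using assms(6) True
      by (intro poly_eqI) (auto simp: coeff_monom coeff_eq_0)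
    then have "control_matrix n n (0\<^sub>m n n) C"
      using control_matrix_zero_matrix assms(7,10) by simp
    then show ?thesis
      using True by auto
  next
    case False
    then have "k < n" and deg: "degree h < n"
      using assms(4,9) by auto
    let ?H = "remainder_matrix n a h"
    have zero: "coeff h l = 0" if "k < l" for l
      using that assms(9) by (intro coeff_eq_0) simp
    have entry: "entry1 ?H i j =
        (if j \<le> i - 1 then - ((\<sigma> ^^ (i - 1)) (coeff h (n - i + j)) * (\<sigma> ^^ (j - 1)) a0)
         else (\<sigma> ^^ (i - 1)) (coeff h (j - i)))" if "i \<in> {1..n}" "j \<in> {1..n}" for i j
      using entry1_remainder_matrix[OF that] assms(11) by simp
    have control: "control_matrix n n ?H C"
      unfolding assms(10) by (rule control_matrix_remainder_matrix[OF assms(2,3) deg assms(7,8)])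
    have first: "entry1 ?H 1 j = coeff h (j - 1)" if "j \<in> {1..n}" for j
      using entry[of 1 j] that by simp
    have first_band: "entry1 ?H 1 j = (if j \<le> k + 1 then coeff h (j - 1) else 0)"
      if "j \<in> {1..n}" for j
      using first[OF that] zero[of "j - 1"] by simp
    have wrapped: "entry1 ?H i j =
        (if j \<le> i - 1 then - ((\<sigma> ^^ (i - 1)) (coeff h (n - i + j)) * (\<sigma> ^^ (j - 1)) a0)
         else (\<sigma> ^^ (i - 1)) (coeff h (j - i)))" if "i \<in> {2..n}" "j \<in> {1..n}" for i j
      using that by (intro entry) auto
    have middle: "entry1 ?H i j =
        (if j \<le> i - 1 then 0
         else if j \<le> i + k then (\<sigma> ^^ (i - 1)) (coeff h (j - i))
         else 0)" if "i \<in> {2..n - k}" "j \<in> {1..n}" for i j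
    proof -
      have ij: "i \<in> {1..n}"
        using that by auto
      have wrap: "coeff h (n - i + j) = 0"
        using that by (intro zero) auto
      have "coeff h (j - i) = 0" if "\<not> j \<le> i + k"
        using that by (intro zero) auto
      then show ?thesis
        by (simp add: entry[OF ij that(2)] wrap)
    qed
    have final: "entry1 ?H i j =
        (if j \<le> i - (n - k) then - ((\<sigma> ^^ (i - 1)) (coeff h (n - i + j)) * (\<sigma> ^^ (j - 1)) a0)
         else if j \<le> i - 1 then 0
         else (\<sigma> ^^ (i - 1)) (coeff h (j - i)))"
      if "i \<in> {n - k + 1..n}" "j \<in> {1..n}" for i j
    proof -
      have ij: "i \<in> {1..n}"
        using that by auto
      have "j \<le> i - 1" if "j \<le> i - (n - k)"
        using that \<open>k < n\<close> by linarith
      moreover have "coeff h (n - i + j) = 0" if "\<not> j \<le> i - (n - k)"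
        using that ij \<open>k < n\<close> by (intro zero) auto
      ultimately show ?thesis
        by (simp add: entry[OF ij that(2)])
    qed
    show ?thesis
      by (intro exI[of _ ?H] conjI impI ballI control first first_band wrapped middle final)
  qed
qed

end
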